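(* Let $0<\delta\le \tfrac34-\tfrac{\sqrt5}{4}$ and $x=\frac{2-2\delta}{3-2\delta}$. Then Algorithm M for the Online Simple Knapsack problem with removability and item size estimates with additive accuracy $\delta$ has competitive ratio at most $\frac1x$, i.e., $\mathrm{OPT}/\mathrm{ALG}\le \frac1x$ on every instance with accuracy $\delta$.
   Context: Online Simple Knapsack with Removability and Item Size Estimates (additive accuracy $\delta\ge0$): an instance consists of actual sizes $x_1,\dots,x_n\in[0,1]$ and estimates $x_1',\dots,x_n'$ with $x_i'-\delta\le x_i\le x_i'+\delta$. A deterministic online algorithm knows $\delta$ and all estimates from the start; actual sizes are revealed one at a time. When an item is revealed, the algorithm may first permanently discard any subset of the items in its knapsack (capacity $1$), and then either pack the item (only if it fits) or reject it permanently. $\mathrm{ALG}$ is the total size in the knapsack at the end; $\mathrm{OPT}$ is the maximum total size of a subset of actual items with sum at most $1$. Algorithm M: an item of actual size at most $1-x$ is small, of size strictly between $1-x$ and $x$ is medium, and of size at least $x$ is large. Let $x_l$ be the last item with estimate $x_l'>1-x-\delta$. For each arriving item $y$: if the total currently packed is at least $x$, stop (reject all remaining items). If $y$ is large, discard everything, pack $y$, and stop. If $y$ is small, pack it if it fits. If $y$ is medium: if no medium item is currently packed, pack $y$, first discarding small items one at a time until $y$ fits; otherwise let $z$ be the packed medium item: if $y+z\le1$, discard everything except $z$, pack $y$ and stop; else if $y<z$, or $y$ is $x_l$ and $y>z$, discard $z$ and pack $y$ (discarding small items one at a time until $y$ fits); otherwise reject $y$.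
   Formalization: Replacement rule corrected: when y is x_l, z is replaced only if y>z; y<z triggers replacement only if y is not x_l. As literally written the claim fails: δ=0.01, exact sizes 0.66, 0.345 give ALG=0.345, OPT=0.66, ratio above 1/x. *)

theory Defs
  imports Complex_Main
begin

text \<open>
  Items are the indices \<open>0, ..., n - 1\<close> in order of arrival; \<open>xs\<close> lists the actual sizes,
  \<open>es\<close> the estimates. A knapsack is the set of packed indices.
\<close>

definition accurate_instance :: "real \<Rightarrow> real list \<Rightarrow> real list \<Rightarrow> bool" where
  "accurate_instance \<delta> xs es \<longleftrightarrow>
     length es = length xs \<and>
     (\<forall>i<length xs. 0 \<le> xs ! i \<and> xs ! i \<le> 1 \<and> es ! i - \<delta> \<le> xs ! i \<and> xs ! i \<le> es ! i + \<delta>)"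

definition total :: "real list \<Rightarrow> nat set \<Rightarrow> real" where
  "total xs K = (\<Sum>i\<in>K. xs ! i)"

definition OPT :: "real list \<Rightarrow> real" where
  "OPT xs = Max (total xs ` {K. K \<subseteq> {..<length xs} \<and> total xs K \<le> 1})"

text \<open>
  \<open>A xs es\<close> is the final knapsack total of the algorithm. The product form also covers
  instances with \<open>A xs es = 0\<close>, where HOL's \<open>OPT / 0 = 0\<close> would make a bound on the quotient
  vacuous; here it forces \<open>OPT xs = 0\<close>.
\<close>

definition competitive_ratio_at_most ::
    "real \<Rightarrow> (real list \<Rightarrow> real list \<Rightarrow> real) \<Rightarrow> real \<Rightarrow> bool" where
  "competitive_ratio_at_most \<delta> A c \<longleftrightarrow>
     (\<forall>xs es. accurate_instance \<delta> xs es \<longrightarrow> OPT xs \<le> c * A xs es)"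

definition small :: "real \<Rightarrow> real \<Rightarrow> bool" where
  "small x s \<longleftrightarrow> s \<le> 1 - x"

definition medium :: "real \<Rightarrow> real \<Rightarrow> bool" where
  "medium x s \<longleftrightarrow> 1 - x < s \<and> s < x"

definition large :: "real \<Rightarrow> real \<Rightarrow> bool" where
  "large x s \<longleftrightarrow> x \<le> s"

text \<open>\<open>i\<close> is the item \<open>x\<^sub>l\<close>; no index satisfies this if no estimate exceeds \<open>1 - x - \<delta>\<close>.\<close>

definition is_last_candidate :: "real \<Rightarrow> real \<Rightarrow> real list \<Rightarrow> nat \<Rightarrow> bool" where
  "is_last_candidate \<delta> x es i \<longleftrightarrow>
     i < length es \<and> es ! i > 1 - x - \<delta> \<and>
     (\<forall>j. i < j \<and> j < length es \<longrightarrow> \<not> es ! j > 1 - x - \<delta>)"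

text \<open>
  Algorithm M does not say in which order small items are discarded. A policy picks the next one
  from all estimates, the sizes revealed so far and the set of small items still packed.
\<close>

type_synonym policy = "real list \<Rightarrow> real list \<Rightarrow> nat set \<Rightarrow> nat"

definition discard_policy :: "policy \<Rightarrow> bool" where
  "discard_policy pick \<longleftrightarrow> (\<forall>es rs S. finite S \<and> S \<noteq> {} \<longrightarrow> pick es rs S \<in> S)"

definition discard_one :: "real \<Rightarrow> policy \<Rightarrow> real list \<Rightarrow> real list \<Rightarrow> nat \<Rightarrow> nat set \<Rightarrow> nat set" where
  "discard_one x pick es xs i K = K - {pick es (take (Suc i) xs) {j \<in> K. small x (xs ! j)}}"

definition make_room :: "real \<Rightarrow> policy \<Rightarrow> real list \<Rightarrow> real list \<Rightarrow> nat \<Rightarrow> nat set \<Rightarrow> nat set" where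
  "make_room x pick es xs i K =
     (let k = (LEAST k. total xs ((discard_one x pick es xs i ^^ k) K) + xs ! i \<le> 1)
      in (discard_one x pick es xs i ^^ k) K)"

text \<open>
  The state is a flag telling whether the algorithm has stopped, and the knapsack.

  In the replacement test the clause \<open>y < z\<close> is for items other than \<open>x\<^sub>l\<close>; at \<open>x\<^sub>l\<close> the larger of
  \<open>y\<close> and \<open>z\<close> is kept. Swapping in a smaller \<open>x\<^sub>l\<close> as well would break the ratio: for
  \<open>\<delta> = 0.01\<close> and sizes \<open>0.66, 0.345\<close> with exact estimates it would leave \<open>0.345\<close>, against an
  optimum of \<open>0.66\<close>.
\<close>

definition M_step ::
    "real \<Rightarrow> real \<Rightarrow> policy \<Rightarrow> real list \<Rightarrow> real list \<Rightarrow> nat \<Rightarrow> bool \<times> nat set \<Rightarrow> bool \<times> nat set" where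
  "M_step \<delta> x pick es xs i st =
     (let (stopped, K) = st; y = xs ! i in
      if stopped \<or> total xs K \<ge> x then (True, K)
      else if large x y then (True, {i})
      else if small x y then (False, if total xs K + y \<le> 1 then insert i K else K)
      else if \<not> (\<exists>j\<in>K. medium x (xs ! j)) then (False, insert i (make_room x pick es xs i K))
      else
        let j = (THE j. j \<in> K \<and> medium x (xs ! j)); z = xs ! j in
        if y + z \<le> 1 then (True, {j, i})
        else if (y < z \<and> \<not> is_last_candidate \<delta> x es i) \<or> (is_last_candidate \<delta> x es i \<and> y > z)
          then (False, insert i (make_room x pick es xs i (K - {j})))
        else (False, K))"

definition ALG_M :: "real \<Rightarrow> real \<Rightarrow> policy \<Rightarrow> real list \<Rightarrow> real list \<Rightarrow> real" where
  "ALG_M \<delta> x pick xs es =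
     total xs (snd (fold (M_step \<delta> x pick es xs) [0..<length xs] (False, {})))"

end

theory Submission
  imports Defs
begin

text \<open>
  If the knapsack total ever reaches \<open>x\<close>, the ratio is at most \<open>1 / x\<close> because \<open>OPT \<le> 1\<close>. This
  happens as soon as a large item arrives, two medium items fit together (\<open>2 * (1 - x) \<ge> x\<close>), or a
  small item is rejected or discarded. Otherwise the knapsack consists of all small items, of total
  size \<open>S\<close>, and at most one medium item \<open>z\<close>, while the optimum contains at most one medium item,
  so \<open>OPT < x + S\<close>. If \<open>x\<^sub>l\<close> is medium, then \<open>z\<close> is the only medium item or \<open>z > 1 / 2\<close>, and
  \<open>1 / 2 \<ge> x\<^sup>2\<close>. If \<open>x\<^sub>l\<close> is small, then \<open>S \<ge> x\<^sub>l > 1 - x - 2 * \<delta>\<close> and \<open>z > 1 - x\<close>, and \<open>x\<close> is the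
  number for which these bounds give \<open>z + S > x * (x + S)\<close>.
\<close>

section \<open>Totals and discarding small items until an arriving item fits\<close>

lemma total_insert:
  "finite K \<Longrightarrow> i \<notin> K \<Longrightarrow> total xs (insert i K) = xs ! i + total xs K"
  by (simp add: total_def)

lemma total_mono:
  assumes "finite L" "K \<subseteq> L" "\<And>i. i \<in> L \<Longrightarrow> 0 \<le> xs ! i"
  shows "total xs K \<le> total xs L"
  unfolding total_def using assms by (intro sum_mono2) auto

lemma discard_iterate_subset: "(discard_one x pick es xs i ^^ k) K \<subseteq> K"
  by (induction k) (auto simp: discard_one_def)

lemma discard_one_small:
  assumes "discard_policy pick" "finite K" "K \<noteq> {}" "\<And>j. j \<in> K \<Longrightarrow> small x (xs ! j)"
  obtains p where "p \<in> K" "discard_one x pick es xs i K = K - {p}"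
proof -
  have "{j \<in> K. small x (xs ! j)} = K"
    using assms(4) by auto
  then show ?thesis
    using assms that[of "pick es (take (Suc i) xs) K"]
    by (auto simp: discard_policy_def discard_one_def)
qed

text \<open>Each round removes one packed item, so induction on the cardinality exhausts the set.
  For an arriving item of size at most 1 the \<open>LEAST\<close> in \<open>make_room\<close> is
  thus attained.\<close>

lemma discard_iterate_empty:
  assumes "discard_policy pick" "finite K" "\<And>j. j \<in> K \<Longrightarrow> small x (xs ! j)"
  shows "\<exists>k. (discard_one x pick es xs i ^^ k) K = {}"
  using assms(2,3)
proof (induction "card K" arbitrary: K)
  case 0
  then show ?case by (auto intro: exI[of _ 0])
next
  case (Suc m)
  then have "K \<noteq> {}" by auto
  then obtain p where p: "p \<in> K" "discard_one x pick es xs i K = K - {p}"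
    using discard_one_small[OF assms(1)] Suc.prems by metis
  have "\<exists>k. (discard_one x pick es xs i ^^ k) (K - {p}) = {}"
    using Suc p by (intro Suc.hyps(1)) auto
  then obtain k where "(discard_one x pick es xs i ^^ k) (K - {p}) = {}" ..
  then have "(discard_one x pick es xs i ^^ Suc k) K = {}"
    using p(2) by (simp add: funpow_Suc_right del: funpow.simps)
  then show ?case ..
qed

lemma make_room_subset: "make_room x pick es xs i K \<subseteq> K"
  unfolding make_room_def Let_def by (rule discard_iterate_subset)

text \<open>Before the last discard the item did not fit, so the joint total exceeded 1; the
  discarded small item accounts for at most \<open>1 - x\<close> of it, so more than
  \<open>x\<close> remains.\<close>

lemma make_room_unchanged_or_full:
  assumes pick: "discard_policy pick" and fin: "finite K"
    and sm: "\<And>j. j \<in> K \<Longrightarrow> small x (xs ! j)" and le1: "xs ! i \<le> 1"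
  shows "make_room x pick es xs i K = K \<or> x < xs ! i + total xs (make_room x pick es xs i K)"
proof -
  define D where "D k = (discard_one x pick es xs i ^^ k) K" for k
  define fits where "fits k \<longleftrightarrow> total xs (D k) + xs ! i \<le> 1" for k
  define m where "m = (LEAST k. fits k)"
  have room: "make_room x pick es xs i K = D m"
    by (simp add: make_room_def D_def fits_def m_def Let_def)
  show ?thesis
  proof (cases m)
    case 0
    then show ?thesis by (simp add: room D_def)
  next
    case (Suc k)
    have "\<not> fits k"
      using not_less_Least[of k fits] Suc by (simp add: m_def)
    then have full: "total xs (D k) + xs ! i > 1"
      by (simp add: fits_def)
    have sub: "D k \<subseteq> K"
      unfolding D_def by (rule discard_iterate_subset)
    then have finD: "finite (D k)"
      using fin finite_subset by blast
    \<comment> \<open>With nothing left in the knapsack the item would fit, because its size is at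
      most 1.\<close>
    have ne: "D k \<noteq> {}"
      using full le1 by (auto simp: total_def)
    obtain p where p: "p \<in> D k" "discard_one x pick es xs i (D k) = D k - {p}"
      using discard_one_small[OF pick finD ne] sub sm by (metis subsetD)
    have Dm: "D m = D k - {p}"
      using p(2) by (simp add: Suc D_def)
    have "total xs (D k) = xs ! p + total xs (D k - {p})"
      using p(1) finD by (simp add: total_def sum.remove)
    moreover have "xs ! p \<le> 1 - x"
      using sm p(1) sub by (auto simp: small_def)
    ultimately have "x < xs ! i + total xs (D m)"
      using full Dm by simp
    then show ?thesis by (simp add: room)
  qed
qed

section \<open>Parameter bounds and the invariant of a run\<close>

locale M_run =
  fixes \<delta> x :: real and pick :: policy and xs es :: "real list"
  assumes pick: "discard_policy pick"
    and acc: "accurate_instance \<delta> xs es"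
    and x_half: "1 / 2 < x" and x_two_thirds: "x \<le> 2 / 3"
    and x_balance: "x * x \<le> (1 - x) * (2 - x - 2 * \<delta>)"
begin

definition smalls :: "nat \<Rightarrow> nat set" where
  "smalls t = {i. i < t \<and> small x (xs ! i)}"

text \<open>
  The three alternatives for the packed medium item \<open>j\<close>: only \<open>j\<close> has been medium; \<open>x\<^sub>l\<close> has not
  arrived or is not medium; \<open>x\<^sub>l\<close> was medium and competed with another medium item.
\<close>

definition kept_medium :: "nat \<Rightarrow> nat \<Rightarrow> bool" where
  "kept_medium t j \<longleftrightarrow>
     (\<forall>i<t. medium x (xs ! i) \<longrightarrow> i = j) \<or>
     ((\<forall>i<t. medium x (xs ! i) \<longrightarrow> xs ! j \<le> xs ! i) \<and>
       (\<forall>l<t. is_last_candidate \<delta> x es l \<longrightarrow> \<not> medium x (xs ! l))) \<or>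
     (1 / 2 < xs ! j \<and> (\<forall>i<length xs. t \<le> i \<longrightarrow> \<not> medium x (xs ! i)))"

text \<open>The overflow of pairs is recorded for all revealed medium items, not only packed ones,
  since the optimum may choose among all of them.\<close>

definition running :: "nat \<Rightarrow> nat set \<Rightarrow> bool" where
  "running t K \<longleftrightarrow>
     (\<forall>i<t. \<not> large x (xs ! i)) \<and>
     ((\<forall>i<t. \<not> medium x (xs ! i)) \<and> K = smalls t \<or>
      (\<exists>j<t. medium x (xs ! j) \<and> K = insert j (smalls t) \<and> kept_medium t j \<and>
         (\<forall>i<t. \<forall>k<t. i \<noteq> k \<and> medium x (xs ! i) \<and> medium x (xs ! k) \<longrightarrow> 1 < xs ! i + xs ! k)))"

text \<open>A knapsack of total at least \<open>x\<close> is never changed again and already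
  guarantees the ratio, so nothing further is tracked for it.\<close>

definition invariant :: "nat \<Rightarrow> bool \<times> nat set \<Rightarrow> bool" where
  "invariant t st \<longleftrightarrow> x \<le> total xs (snd st) \<or> \<not> fst st \<and> running t (snd st)"

lemma nonneg: "i < length xs \<Longrightarrow> 0 \<le> xs ! i"
  using acc by (simp add: accurate_instance_def)

lemma size_cases: obtains "large x s" | "small x s" | "medium x s"
  unfolding large_def small_def medium_def by (meson not_le)

lemma not_two_classes:
  "small x s \<Longrightarrow> \<not> medium x s" "medium x s \<Longrightarrow> \<not> small x s"
  "small x s \<Longrightarrow> \<not> large x s" "medium x s \<Longrightarrow> \<not> large x s"
  using x_half by (auto simp: large_def small_def medium_def)

lemma finite_smalls [simp]: "finite (smalls t)"
  by (simp add: smalls_def)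

lemma smalls_Suc:
  "smalls (Suc t) = (if small x (xs ! t) then insert t (smalls t) else smalls t)"
  by (auto simp: smalls_def less_Suc_eq)

text \<open>Past \<open>x\<^sub>l\<close> every estimate is at most \<open>1 - x - \<delta>\<close>,
  so accuracy bounds the actual size by \<open>1 - x\<close>.\<close>

lemma medium_not_after_last:
  assumes "is_last_candidate \<delta> x es l" "l < i" "i < length xs"
  shows "\<not> medium x (xs ! i)"
proof -
  have "\<not> es ! i > 1 - x - \<delta>" "xs ! i \<le> es ! i + \<delta>"
    using assms acc by (auto simp: is_last_candidate_def accurate_instance_def)
  then show ?thesis by (simp add: medium_def)
qed

section \<open>Preservation of the invariant by one step\<close>

lemma running_Suc_small:
  assumes run: "running t K" and sm: "small x (xs ! t)"
  shows "running (Suc t) (insert t K)"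
proof -
  have not_med: "\<not> medium x (xs ! t)" and "\<not> large x (xs ! t)"
    using sm not_two_classes by auto
  then have no_large: "\<forall>i<Suc t. \<not> large x (xs ! i)"
    using run by (auto simp: running_def less_Suc_eq)
  have medium_Suc: "i < Suc t \<and> medium x (xs ! i) \<longleftrightarrow> i < t \<and> medium x (xs ! i)" for i
    using not_med by (auto simp: less_Suc_eq)
  from run consider
      (none) "\<forall>i<t. \<not> medium x (xs ! i)" "K = smalls t"
    | (one) j where "j < t" "medium x (xs ! j)" "K = insert j (smalls t)" "kept_medium t j"
        "\<forall>i<t. \<forall>k<t. i \<noteq> k \<and> medium x (xs ! i) \<and> medium x (xs ! k) \<longrightarrow> 1 < xs ! i + xs ! k"
    unfolding running_def by blast
  then show ?thesis
  proof cases
    case none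
    then have "\<forall>i<Suc t. \<not> medium x (xs ! i)" "insert t K = smalls (Suc t)"
      using medium_Suc sm by (auto simp: smalls_Suc)
    then show ?thesis
      using no_large by (simp add: running_def)
  next
    case (one j)
    have "kept_medium (Suc t) j"
      using one(4) medium_Suc unfolding kept_medium_def by (meson Suc_leD)
    moreover have "insert t K = insert j (smalls (Suc t))"
      using one(3) sm by (auto simp: smalls_Suc)
    ultimately show ?thesis
      unfolding running_def using no_large one(1,2,5) medium_Suc by (meson less_SucI)
  qed
qed

lemma running_Suc_first_medium:
  assumes run: "running t K" and med: "medium x (xs ! t)"
    and none: "\<And>i. i < t \<Longrightarrow> \<not> medium x (xs ! i)"
  shows "running (Suc t) (insert t K)"
proof -
  have only: "i = t" if "i < Suc t" "medium x (xs ! i)" for i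
    using that none by (auto simp: less_Suc_eq)
  have "K = smalls (Suc t)"
    using run none med not_two_classes by (auto simp: running_def smalls_Suc)
  moreover have "kept_medium (Suc t) t"
    using only by (auto simp: kept_medium_def)
  moreover have "\<forall>i<Suc t. \<not> large x (xs ! i)"
    using run med not_two_classes by (auto simp: running_def less_Suc_eq)
  ultimately show ?thesis
    unfolding running_def using only med by (metis lessI)
qed

text \<open>Reduces packing a medium item to the case without discards: any discard leaves a total
  above \<open>x\<close>, which is the first alternative of \<open>invariant\<close>.\<close>

lemma make_room_smalls:
  assumes t: "t < length xs" and med: "medium x (xs ! t)"
    and run: "running (Suc t) (insert t (smalls t))"
  shows "invariant (Suc t) (False, insert t (make_room x pick es xs t (smalls t)))"
proof -
  let ?R = "make_room x pick es xs t (smalls t)"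
  have sub: "?R \<subseteq> smalls t" by (rule make_room_subset)
  then have "finite ?R" "t \<notin> ?R"
    using finite_subset[OF sub] by (auto simp: smalls_def)
  then have "total xs (insert t ?R) = xs ! t + total xs ?R"
    by (rule total_insert)
  moreover have "?R = smalls t \<or> x < xs ! t + total xs ?R"
    using acc t by (intro make_room_unchanged_or_full[OF pick])
      (auto simp: smalls_def accurate_instance_def)
  ultimately show ?thesis
    using run by (auto simp: invariant_def)
qed

lemma invariant_step:
  assumes t: "t < length xs" and inv: "invariant t st"
  shows "invariant (Suc t) (M_step \<delta> x pick es xs t st)"
proof (cases "fst st \<or> x \<le> total xs (snd st)")
  case True
  then show ?thesis
    using inv by (cases st) (auto simp: invariant_def M_step_def)
next
  case False
  then obtain K where st: "st = (False, K)" and lt: "total xs K < x" and run: "running t K"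
    using inv by (cases st) (auto simp: invariant_def)
  show ?thesis
  proof (cases rule: size_cases[of "xs ! t"])
    case 1
    then show ?thesis
      using lt by (simp add: st M_step_def invariant_def total_def large_def)
  next
    case 2
    \<comment> \<open>A total below \<open>x\<close> leaves room for any small item, so none is
      rejected here.\<close>
    then have "total xs K + xs ! t \<le> 1"
      using lt by (simp add: small_def)
    then show ?thesis
      using lt 2 not_two_classes[of "xs ! t"] running_Suc_small[OF run]
      by (simp add: st M_step_def invariant_def)
  next
    case med: 3
    then have not_large: "\<not> large x (xs ! t)" and not_small: "\<not> small x (xs ! t)"
      using not_two_classes by auto
    from run consider
        (none) "\<And>i. i < t \<Longrightarrow> \<not> medium x (xs ! i)" "K = smalls t"
      | (one) j where "j < t" "medium x (xs ! j)" "K = insert j (smalls t)" "kept_medium t j"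
          "\<And>i k. i < t \<Longrightarrow> k < t \<Longrightarrow> i \<noteq> k \<Longrightarrow> medium x (xs ! i) \<Longrightarrow> medium x (xs ! k)
            \<Longrightarrow> 1 < xs ! i + xs ! k"
      unfolding running_def by blast
    then show ?thesis
    proof cases
      case none
      have "\<not> (\<exists>j\<in>K. medium x (xs ! j))"
        using none by (auto simp: smalls_def)
      then have "M_step \<delta> x pick es xs t st = (False, insert t (make_room x pick es xs t (smalls t)))"
        using lt not_large not_small none(2) by (simp add: st M_step_def)
      then show ?thesis
        using make_room_smalls[OF t med] running_Suc_first_medium[OF run med none(1)] none(2)
        by simp
    next
      case (one j)
      have uniq: "(THE j. j \<in> K \<and> medium x (xs ! j)) = j"
        using one(2,3) not_two_classes(1) by (intro the_equality) (auto simp: smalls_def)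
      have ex: "\<exists>j\<in>K. medium x (xs ! j)"
        using one by auto
      have j_notin: "j \<notin> smalls t"
        using one(2) not_two_classes by (auto simp: smalls_def)
      have K_minus: "K - {j} = smalls t"
        using one(3) j_notin by auto
      \<comment> \<open>The third alternative of \<open>kept_medium\<close> is excluded because the
        arriving item \<open>t\<close> is medium; the other two make \<open>j\<close> a smallest
        medium item so far.\<close>
      have minimal: "xs ! j \<le> xs ! i" if "i < t" "medium x (xs ! i)" for i
        using one(4) that t med unfolding kept_medium_def by fastforce
      have no_last: "\<not> is_last_candidate \<delta> x es l" if "l < t" for l
        using medium_not_after_last[OF _ that t] med by blast
      let ?swap = "xs ! t < xs ! j \<and> \<not> is_last_candidate \<delta> x es t \<or>
        is_last_candidate \<delta> x es t \<and> xs ! j < xs ! t"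
      have step: "M_step \<delta> x pick es xs t st =
          (if xs ! t + xs ! j \<le> 1 then (True, {j, t})
           else if ?swap then (False, insert t (make_room x pick es xs t (smalls t)))
           else (False, K))"
        using lt not_large not_small ex
        by (simp add: st M_step_def uniq K_minus Let_def)
      show ?thesis
      proof (cases "xs ! t + xs ! j \<le> 1")
        case True
        have "x \<le> xs ! j + xs ! t"
          using one(2) med x_two_thirds by (simp add: medium_def)
        then show ?thesis
          using one(1) True by (simp add: step invariant_def total_def)
      next
        case False
        \<comment> \<open>Since \<open>j\<close> is smallest, overflow with \<open>j\<close> forces
          overflow with every earlier medium item, including rejected or replaced ones.\<close>
        have pair_t: "1 < xs ! i + xs ! t" if "i < t" "medium x (xs ! i)" for i
          using minimal[OF that] False by simp
        have pairs: "1 < xs ! i + xs ! k"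
          if "i < Suc t" "k < Suc t" "i \<noteq> k" "medium x (xs ! i)" "medium x (xs ! k)" for i k
          using that one(5) pair_t[of i] pair_t[of k]
          by (auto simp: less_Suc_eq add.commute)
        have no_large: "\<And>i. i < Suc t \<Longrightarrow> \<not> large x (xs ! i)"
          using run not_large by (auto simp: running_def less_Suc_eq)
        have none_after: "\<not> medium x (xs ! i)"
          if "is_last_candidate \<delta> x es t" "i < length xs" "Suc t \<le> i" for i
          using medium_not_after_last[OF that(1)] that by auto
        have runI: "running (Suc t) (insert j' (smalls t))"
          if "j' < Suc t" "medium x (xs ! j')" "kept_medium (Suc t) j'" for j'
          using that no_large pairs not_small unfolding running_def smalls_Suc by auto
        show ?thesis
        proof (cases ?swap)
          case True
          have "kept_medium (Suc t) t"
          proof (cases "is_last_candidate \<delta> x es t")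
            case last: True
            \<comment> \<open>The larger of two items with sum above 1 exceeds 1/2. No medium item
              follows \<open>x\<^sub>l\<close>, so the third alternative of
              \<open>kept_medium\<close> holds.\<close>
            then have "1 / 2 < xs ! t"
              using True False by auto
            then show ?thesis
              using none_after[OF last] by (auto simp: kept_medium_def)
          next
            case not_last: False
            then have "\<And>i. i < t \<Longrightarrow> medium x (xs ! i) \<Longrightarrow> xs ! t \<le> xs ! i"
              using minimal True by fastforce
            then show ?thesis
              using not_last no_last by (auto simp: kept_medium_def less_Suc_eq)
          qed
          then show ?thesis
            using runI[of t] med make_room_smalls[OF t med] True False by (simp add: step)
        next
          case stay: False
          have "kept_medium (Suc t) j"
          proof (cases "is_last_candidate \<delta> x es t")
            case last: True
            \<comment> \<open>Keeping \<open>j\<close> at \<open>x\<^sub>l\<close> means that the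
              arriving item is no larger, so \<open>j\<close> is at least half of a sum above
              1.\<close>
            then have "1 / 2 < xs ! j"
              using stay False by auto
            then show ?thesis
              using none_after[OF last] by (auto simp: kept_medium_def)
          next
            case not_last: False
            then have "xs ! j \<le> xs ! t"
              using stay by auto
            then show ?thesis
              using not_last no_last minimal by (auto simp: kept_medium_def less_Suc_eq)
          qed
          then have "running (Suc t) K"
            using runI[of j] one by simp
          then show ?thesis
            using stay False by (auto simp: step invariant_def)
        qed
      qed
    qed
  qed
qed

lemma invariant_fold:
  "t \<le> length xs \<Longrightarrow> invariant t (fold (M_step \<delta> x pick es xs) [0..<t] (False, {}))"
proof (induction t)
  case 0
  then show ?case by (simp add: invariant_def running_def smalls_def)
next
  case (Suc t)
  then show ?case using invariant_step[of t] by simp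
qed

section \<open>Comparison of the final knapsack with feasible sets\<close>

lemma last_candidate_exists:
  assumes "w < length xs" "medium x (xs ! w)"
  obtains l where "l < length xs" "is_last_candidate \<delta> x es l"
proof -
  let ?C = "{i. i < length es \<and> 1 - x - \<delta> < es ! i}"
  have len: "length es = length xs" and "xs ! w \<le> es ! w + \<delta>"
    using acc assms(1) by (auto simp: accurate_instance_def)
  \<comment> \<open>A size above \<open>1 - x\<close> forces an estimate above
    \<open>1 - x - \<delta>\<close>, so a medium item is a candidate for
    \<open>x\<^sub>l\<close>.\<close>
  then have "w \<in> ?C"
    using assms by (simp add: medium_def)
  then have "?C \<noteq> {}" by blast
  moreover have "finite ?C" by simp
  moreover define l where "l = Max ?C"
  ultimately have l: "l \<in> ?C"
    using Max_in by blast
  have "j \<le> l" if "j \<in> ?C" for j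
    unfolding l_def using that by (intro Max_ge) simp
  then have "is_last_candidate \<delta> x es l"
    using l unfolding is_last_candidate_def by fastforce
  then show ?thesis
    using that[of l] l len by simp
qed

lemma running_total_bound:
  assumes run: "running (length xs) K" and L: "L \<subseteq> {..<length xs}" "total xs L \<le> 1"
  shows "x * total xs L \<le> total xs K"
proof -
  let ?n = "length xs"
  let ?S = "total xs (smalls ?n)"
  have finL: "finite L" using L(1) finite_subset by blast
  have sub_n: "smalls ?n \<subseteq> {..<?n}" by (auto simp: smalls_def)
  have total_nonneg: "0 \<le> total xs A" if "A \<subseteq> {..<?n}" for A
    unfolding total_def using that nonneg by (intro sum_nonneg) auto
  have S0: "0 \<le> ?S" using total_nonneg sub_n by blast
  have scale: "x * total xs L \<le> total xs L"
    using total_nonneg[OF L(1)] x_two_thirds x_half by (simp add: mult_left_le_one_le)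
  have no_large: "\<And>i. i < ?n \<Longrightarrow> \<not> large x (xs ! i)"
    using run by (simp add: running_def)
  have KS: "?S \<le> total xs K"
  proof (rule total_mono)
    show "finite K" "smalls ?n \<subseteq> K" using run by (auto simp: running_def)
    show "0 \<le> xs ! i" if "i \<in> K" for i
      using that run nonneg by (auto simp: running_def smalls_def)
  qed
  have rest: "total xs A \<le> ?S" if "A \<subseteq> {..<?n}" "\<And>i. i \<in> A \<Longrightarrow> \<not> medium x (xs ! i)" for A
  proof (rule total_mono)
    show "A \<subseteq> smalls ?n"
    proof
      fix i assume "i \<in> A"
      then show "i \<in> smalls ?n"
        using that no_large[of i] by (cases rule: size_cases[of "xs ! i"]) (auto simp: smalls_def)
    qed
    show "0 \<le> xs ! i" if "i \<in> smalls ?n" for i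
      using that nonneg by (auto simp: smalls_def)
  qed simp
  show ?thesis
  proof (cases "\<exists>w\<in>L. medium x (xs ! w)")
    case False
    then show ?thesis using rest[OF L(1)] KS scale by force
  next
    case True
    then obtain w where w: "w \<in> L" "medium x (xs ! w)" by blast
    then have wn: "w < ?n" using L(1) by auto
    then obtain j where j: "j < ?n" "medium x (xs ! j)" "K = insert j (smalls ?n)"
        "kept_medium ?n j"
      and pairs: "\<And>i k. i < ?n \<Longrightarrow> k < ?n \<Longrightarrow> i \<noteq> k \<Longrightarrow> medium x (xs ! i)
            \<Longrightarrow> medium x (xs ! k) \<Longrightarrow> 1 < xs ! i + xs ! k"
      using run w(2) unfolding running_def by blast
    have "j \<notin> smalls ?n"
      using j(2) not_two_classes by (auto simp: smalls_def)
    then have K: "total xs K = xs ! j + ?S"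
      using j(3) by (simp add: total_insert)
    \<comment> \<open>A second medium item in \<open>L\<close> would together with \<open>w\<close>
      already exceed the capacity.\<close>
    have "\<not> medium x (xs ! i)" if "i \<in> L - {w}" for i
    proof
      assume "medium x (xs ! i)"
      moreover have "i < ?n" using that L(1) by auto
      ultimately have "1 < total xs {i, w}"
        using pairs[of i w] wn w(2) that by (simp add: total_def)
      also have "\<dots> \<le> total xs L"
        using that w(1) finL L(1) nonneg by (intro total_mono) auto
      finally show False using L(2) by simp
    qed
    then have "total xs (L - {w}) \<le> ?S"
      using L(1) by (intro rest) auto
    moreover have "total xs L = xs ! w + total xs (L - {w})"
      using w(1) finL by (simp add: total_def sum.remove)
    ultimately have L_le: "total xs L \<le> xs ! w + ?S" by simp
    also have "\<dots> \<le> x + ?S" using w(2) by (simp add: medium_def)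
    finally have "x * total xs L \<le> x * (x + ?S)"
      using x_half by (intro mult_left_mono) auto
    then have bound: "x * total xs L \<le> x * x + x * ?S"
      by (simp add: algebra_simps)
    obtain l where l: "l < ?n" "is_last_candidate \<delta> x es l"
      using last_candidate_exists[OF wn w(2)] .
    \<comment> \<open>The three alternatives of \<open>kept_medium\<close>, instantiated at
      \<open>w\<close> and \<open>l\<close>.\<close>
    from j(4) consider
        (only) "w = j"
      | (min) "\<not> medium x (xs ! l)"
      | (half) "1 / 2 < xs ! j"
      unfolding kept_medium_def using wn w(2) l by blast
    then show ?thesis
    proof cases
      case only
      then show ?thesis using L_le K scale by simp
    next
      case min
      then have "small x (xs ! l)"
        using no_large[OF l(1)] size_cases by blast
      then have "total xs {l} \<le> ?S"
        using l(1) nonneg by (intro total_mono) (auto simp: smalls_def)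
      moreover have "es ! l \<le> xs ! l + \<delta>" "1 - x - \<delta> < es ! l"
        using l acc by (auto simp: accurate_instance_def is_last_candidate_def)
      ultimately have "1 - x - 2 * \<delta> \<le> ?S" by (simp add: total_def)
      \<comment> \<open>By \<open>bound\<close> it suffices that
        \<open>x * x \<le> xs ! j + (1 - x) * ?S\<close>, whence the factor \<open>1 - x\<close>.
        Inserting the lower bounds for \<open>?S\<close> and \<open>xs ! j\<close> yields the right
        side of \<open>x_balance\<close>.\<close>
      then have "(1 - x) * (1 - x - 2 * \<delta>) \<le> (1 - x) * ?S"
        using x_two_thirds by (intro mult_left_mono) auto
      moreover have "1 - x < xs ! j" using j(2) by (simp add: medium_def)
      ultimately show ?thesis
        using bound K x_balance by (simp add: algebra_simps)
    next
      case half
      \<comment> \<open>The value 4/9 lies below 1/2, so \<open>xs ! j\<close> alone covers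
        \<open>x * x\<close>.\<close>
      have "x * x \<le> 2 / 3 * (2 / 3)"
        using x_half x_two_thirds by (intro mult_mono) auto
      moreover have "x * ?S \<le> ?S"
        using S0 x_half x_two_thirds by (simp add: mult_left_le_one_le)
      ultimately show ?thesis using bound K half by simp
    qed
  qed
qed

lemma ALG_M_bound:
  assumes "L \<subseteq> {..<length xs}" "total xs L \<le> 1"
  shows "x * total xs L \<le> ALG_M \<delta> x pick xs es"
proof -
  let ?st = "fold (M_step \<delta> x pick es xs) [0..<length xs] (False, {})"
  have "invariant (length xs) ?st" by (simp add: invariant_fold)
  then consider "x \<le> total xs (snd ?st)" | "running (length xs) (snd ?st)"
    by (auto simp: invariant_def)
  then show ?thesis
  proof cases
    case 1
    have "x * total xs L \<le> x" using assms(2) x_half by (simp add: mult_left_le)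
    then show ?thesis using 1 by (simp add: ALG_M_def)
  next
    case 2
    then show ?thesis using running_total_bound[OF _ assms] by (simp add: ALG_M_def)
  qed
qed

lemma OPT_le: "OPT xs \<le> 1 / x * ALG_M \<delta> x pick xs es"
proof -
  let ?F = "{K. K \<subseteq> {..<length xs} \<and> total xs K \<le> 1}"
  have "finite ?F" by (rule finite_subset[of _ "Pow {..<length xs}"]) auto
  moreover have "{} \<in> ?F" by (simp add: total_def)
  ultimately have "OPT xs \<in> total xs ` ?F"
    unfolding OPT_def by (intro Max_in) auto
  then have "x * OPT xs \<le> ALG_M \<delta> x pick xs es"
    using ALG_M_bound by auto
  then show ?thesis using x_half by (simp add: field_simps)
qed

end

section \<open>Range of \<open>x\<close> and the balance identity\<close>

theorem theorem18:
  fixes \<delta> x :: real and pick :: policy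
  assumes "0 < \<delta>" and "\<delta> \<le> 3 / 4 - sqrt 5 / 4"
    and "x = (2 - 2 * \<delta>) / (3 - 2 * \<delta>)"
    and "discard_policy pick"
  shows "competitive_ratio_at_most \<delta> (ALG_M \<delta> x pick) (1 / x)"
proof -
  \<comment> \<open>This gives \<open>\<delta> \<le> 1 / 4\<close>, which places \<open>x\<close>
    between 3/5 and 2/3.\<close>
  have "2 \<le> sqrt 5" by (rule real_le_rsqrt) simp
  then have d: "\<delta> \<le> 1 / 4" using assms(2) by simp
  then have x_eq: "x = 1 - 1 / (3 - 2 * \<delta>)"
    using assms(3) by (simp add: field_simps)
  have "1 / 3 \<le> 1 / (3 - 2 * \<delta>)" "1 / (3 - 2 * \<delta>) \<le> 2 / 5"
    using assms(1) d by (simp_all add: divide_simps)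
  then have half: "1 / 2 < x" and third: "x \<le> 2 / 3"
    by (simp_all add: x_eq)
  \<comment> \<open>This fixed-point form of \<open>x\<close> turns the balance condition into an
    equality: subtracting \<open>x * (1 - x)\<close> from both sides leaves \<open>x * x\<close> on
    the left.\<close>
  have prod: "x = (1 - x) * (2 - 2 * \<delta>)"
    using assms(3) d by (simp add: field_simps)
  have "(1 - x) * (2 - x - 2 * \<delta>) = x - x * (1 - x)"
    by (subst (3) prod) (simp add: algebra_simps)
  then have balance: "x * x \<le> (1 - x) * (2 - x - 2 * \<delta>)"
    by (simp add: algebra_simps)
  show ?thesis
    unfolding competitive_ratio_at_most_def
  proof (intro allI impI)
    fix xs es assume "accurate_instance \<delta> xs es"
    then interpret M_run \<delta> x pick xs es
      using assms(4) half third balance by unfold_locales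
    show "OPT xs \<le> 1 / x * ALG_M \<delta> x pick xs es" by (rule OPT_le)
  qed
qed

end
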